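(* Let $f:\mathbb{R}^d\to\mathbb{R}$ be differentiable, convex and symmetrically $(L_0,L_1)$-smooth with $L_0>0$, $L_1\ge0$, and let $x^*$ be a minimizer of $f$. Let $\{x^k\}_{k\ge0}$ be the iterates of Adaptive Gradient Descent (AdGD) with $\gamma=\frac14$, with stepsizes $\lambda_k$ and ratios $\theta_k$. For $N\ge1$ define $$\hat x^N:=\frac{1}{S_N}\Big(\lambda_N(1+\theta_N)x^N+\sum_{k=1}^{N-1}w_kx^k\Big),\quad w_k:=\lambda_k(1+\theta_k)-\lambda_{k+1}\theta_{k+1},\quad S_N:=\lambda_1\theta_1+\sum_{k=1}^N\lambda_k.$$ Let $\nu$ be the real number with $\nu=e^{-\nu}$, let $D>0$ with $$D^2:=\|x^1-x^*\|^2+\tfrac34\|x^1-x^0\|^2+2\lambda_1\theta_1(f(x^0)-f(x^* )),$$ and let $$m:=1+\log_{\sqrt2}\left\lceil\frac{1+L_1D\exp(2L_1D)}{2}\right\rceil,\qquad K:=\frac{2L_1^2D^2}{\nu^2}.$$ Then for every $N\ge1$ with $N>mK+\frac{\sqrt{2N}(m+1)L_1D}{\nu}$, $$f(\hat x^N)-f(x^* )\le\frac{2L_0D^2}{\nu(N-mK)-\sqrt{2N}(m+1)L_1D}.$$ In particular, for every $N\geq 1$ with $N\ge\Big(2mK+\frac{4(m+1)L_1D}{\nu}\Big)^2$, $$f(\hat x^N)-f(x^* )\le\frac{4L_0D^2}{\nu N}.$$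
   Context: $\|\cdot\|$ is the Euclidean norm. A differentiable $f:\mathbb{R}^d\to\mathbb{R}$ is convex if $f(y)\ge f(x)+\langle\nabla f(x),y-x\rangle$ for all $x,y$. It is symmetrically $(L_0,L_1)$-smooth if for all $x,y\in\mathbb{R}^d$ $$\|\nabla f(x)-\nabla f(y)\|\le\Big(L_0+L_1\sup_{u\in[x,y]}\|\nabla f(u)\|\Big)\|x-y\|,$$ where $[x,y]$ is the line segment between $x$ and $y$. AdGD with parameter $\gamma$: given $x^0\in\mathbb{R}^d$, $\lambda_0>0$, $\theta_0=+\infty$, set $x^1=x^0-\lambda_0\nabla f(x^0)$ and for $k=1,2,\ldots$ $$\lambda_k=\min\left\{\sqrt{1+\theta_{k-1}}\,\lambda_{k-1},\ \frac{\gamma\|x^k-x^{k-1}\|}{\|\nabla f(x^k)-\nabla f(x^{k-1})\|}\right\},\quad x^{k+1}=x^k-\lambda_k\nabla f(x^k),\quad\theta_k=\frac{\lambda_k}{\lambda_{k-1}}.$$ Since $\theta_0=+\infty$, $\lambda_1$ equals the second term in the minimum. It is assumed that the method is well defined, i.e. $\nabla f(x^k)\ne\nabla f(x^{k-1})$ for all $k\ge1$. *)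

theory Defs
  imports "HOL-Analysis.Analysis"
begin

definition grad :: "('a::euclidean_space \<Rightarrow> real) \<Rightarrow> 'a \<Rightarrow> 'a" where
  "grad f x = (THE g. GDERIV f x :> g)"

lemma GDERIV_grad:
  fixes f :: "'a::euclidean_space \<Rightarrow> real"
  assumes "f differentiable (at x)"
  shows "GDERIV f x :> grad f x"
proof -
  obtain f' where f': "(f has_derivative f') (at x)"
    using assms by (auto simp: differentiable_def)
  interpret bounded_linear f'
    using f' by (rule has_derivative_bounded_linear)
  define g where "g = (\<Sum>b\<in>Basis. f' b *\<^sub>R b)"
  have "f' h = inner h g" for h
  proof -
    have "f' h = f' (\<Sum>b\<in>Basis. (h \<bullet> b) *\<^sub>R b)"
      by (simp add: euclidean_representation)
    also have "\<dots> = inner h g"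
      by (simp add: g_def sum scale inner_sum_right mult.commute)
    finally show ?thesis .
  qed
  then have "f' = (\<lambda>h. inner h g)"
    by (simp add: fun_eq_iff)
  then have g: "GDERIV f x :> g"
    using f' by (simp add: gderiv_def)
  have uniq: "k = g" if "GDERIV f x :> k" for k
  proof -
    have "(\<lambda>h. inner h k) = (\<lambda>h. inner h g)"
      using that g unfolding gderiv_def by (rule has_derivative_unique)
    then have "k \<bullet> b = g \<bullet> b" for b
      using fun_cong[of "\<lambda>h. inner h k" "\<lambda>h. inner h g" b] by (simp only: inner_commute[of _ b])
    then show ?thesis
      by (simp add: euclidean_eq_iff[of k g])
  qed
  show ?thesis
    unfolding grad_def using g uniq by (rule theI)
qed

lemma convex_on_UNIV_iff_grad:
  fixes f :: "'a::euclidean_space \<Rightarrow> real"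
  assumes diff: "\<And>x. f differentiable (at x)"
  shows "convex_on UNIV f \<longleftrightarrow> (\<forall>x y. f y \<ge> f x + grad f x \<bullet> (y - x))"
proof
  assume cvx: "convex_on UNIV f"
  show "\<forall>x y. f y \<ge> f x + grad f x \<bullet> (y - x)"
  proof (intro allI)
    fix x y
    define h where "h t = f (x + t *\<^sub>R (y - x))" for t
    have "convex_on UNIV h"
    proof (rule convex_onI)
      fix t a b :: real
      assume "0 < t" "t < 1"
      have "x + ((1 - t) *\<^sub>R a + t *\<^sub>R b) *\<^sub>R (y - x)
          = (1 - t) *\<^sub>R (x + a *\<^sub>R (y - x)) + t *\<^sub>R (x + b *\<^sub>R (y - x))"
        by (simp add: algebra_simps)
      then show "h ((1 - t) *\<^sub>R a + t *\<^sub>R b) \<le> (1 - t) * h a + t * h b"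
        using convex_onD[OF cvx, of t "x + a *\<^sub>R (y - x)" "x + b *\<^sub>R (y - x)"] \<open>0 < t\<close> \<open>t < 1\<close>
        by (simp only: h_def UNIV_I less_imp_le)
    qed simp
    moreover have "(h has_real_derivative grad f x \<bullet> (y - x)) (at 0)"
    proof -
      have "(f has_derivative (\<lambda>v. v \<bullet> grad f x)) (at (x + 0 *\<^sub>R (y - x)))"
        using GDERIV_grad[OF diff, of x] by (simp add: gderiv_def)
      moreover have "((\<lambda>t. x + t *\<^sub>R (y - x)) has_derivative (\<lambda>t. t *\<^sub>R (y - x))) (at (0::real))"
        by (auto intro!: derivative_eq_intros)
      ultimately have "((\<lambda>t. f (x + t *\<^sub>R (y - x))) has_derivative
          (\<lambda>t. (t *\<^sub>R (y - x)) \<bullet> grad f x)) (at 0)"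
        by (rule has_derivative_compose[rotated])
      then have "(h has_derivative (\<lambda>t. (t *\<^sub>R (y - x)) \<bullet> grad f x)) (at 0)"
        by (simp only: h_def[abs_def])
      then show ?thesis
        unfolding has_field_derivative_def
        by (rule has_derivative_eq_rhs) (simp add: fun_eq_iff inner_commute)
    qed
    ultimately have "h 1 - h 0 \<ge> grad f x \<bullet> (y - x) * (1 - 0)"
      by (intro convex_on_imp_above_tangent[where A = UNIV]) auto
    then show "f y \<ge> f x + grad f x \<bullet> (y - x)"
      by (simp add: h_def)
  qed
next
  assume above: "\<forall>x y. f y \<ge> f x + grad f x \<bullet> (y - x)"
  show "convex_on UNIV f"
  proof (rule convex_onI)
    fix t :: real and x y :: 'a
    assume t: "0 < t" "t < 1"
    define z where "z = (1 - t) *\<^sub>R x + t *\<^sub>R y"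
    have "(1 - t) * f x \<ge> (1 - t) * (f z + grad f z \<bullet> (x - z))"
      using t above by (intro mult_left_mono) auto
    moreover have "t * f y \<ge> t * (f z + grad f z \<bullet> (y - z))"
      using t above by (intro mult_left_mono) auto
    moreover have "(1 - t) * (grad f z \<bullet> (x - z)) + t * (grad f z \<bullet> (y - z)) = 0"
    proof -
      have "(1 - t) *\<^sub>R (x - z) + t *\<^sub>R (y - z) = 0"
        by (simp add: z_def algebra_simps)
      then have "grad f z \<bullet> ((1 - t) *\<^sub>R (x - z) + t *\<^sub>R (y - z)) = 0"
        by simp
      then show ?thesis
        by (simp only: inner_add_right inner_scaleR_right)
    qed
    ultimately show "f ((1 - t) *\<^sub>R x + t *\<^sub>R y) \<le> (1 - t) * f x + t * f y"
      unfolding z_def[symmetric] by (simp only: distrib_left left_diff_distrib)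
  qed simp
qed

(* The supremum is taken in ereal, so an unbounded gradient on a segment gives
   the value \<infinity> rather than an unspecified real number. *)
definition sym_smooth :: "real \<Rightarrow> real \<Rightarrow> ('a::euclidean_space \<Rightarrow> real) \<Rightarrow> bool" where
  "sym_smooth L0 L1 f \<longleftrightarrow>
     (\<forall>x y. ereal (norm (grad f x - grad f y))
        \<le> (ereal L0 + ereal L1 * (SUP u\<in>closed_segment x y. ereal (norm (grad f u))))
            * ereal (norm (x - y)))"

(* theta 0 stands for +\<infinity>, which makes the first argument of the minimum
   infinite for k = 1; the real number theta 0 itself is never used. *)
definition adgd ::
  "real \<Rightarrow> ('a::euclidean_space \<Rightarrow> real) \<Rightarrow> (nat \<Rightarrow> 'a) \<Rightarrow> (nat \<Rightarrow> real) \<Rightarrow> (nat \<Rightarrow> real) \<Rightarrow> bool"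
where
  "adgd \<gamma> f x lam theta \<longleftrightarrow>
     lam 0 > 0 \<and>
     x 1 = x 0 - lam 0 *\<^sub>R grad f (x 0) \<and>
     (\<forall>k\<ge>1.
        lam k =
          (let q = \<gamma> * norm (x k - x (k - 1)) / norm (grad f (x k) - grad f (x (k - 1)))
           in if k = 1 then q else min (sqrt (1 + theta (k - 1)) * lam (k - 1)) q) \<and>
        x (k + 1) = x k - lam k *\<^sub>R grad f (x k) \<and>
        theta k = lam k / lam (k - 1))"

definition adgd_weight :: "(nat \<Rightarrow> real) \<Rightarrow> (nat \<Rightarrow> real) \<Rightarrow> nat \<Rightarrow> real" where
  "adgd_weight lam theta k = lam k * (1 + theta k) - lam (k + 1) * theta (k + 1)"

definition adgd_total :: "(nat \<Rightarrow> real) \<Rightarrow> (nat \<Rightarrow> real) \<Rightarrow> nat \<Rightarrow> real" where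
  "adgd_total lam theta N = lam 1 * theta 1 + (\<Sum>k=1..N. lam k)"

definition adgd_avg ::
  "(nat \<Rightarrow> 'a::euclidean_space) \<Rightarrow> (nat \<Rightarrow> real) \<Rightarrow> (nat \<Rightarrow> real) \<Rightarrow> nat \<Rightarrow> 'a"
where
  "adgd_avg x lam theta N =
     (1 / adgd_total lam theta N) *\<^sub>R
       ((lam N * (1 + theta N)) *\<^sub>R x N + (\<Sum>k=1..N - 1. adgd_weight lam theta k *\<^sub>R x k))"

end

(* The AdGD energy is nonincreasing and telescopes to 2 S_N (f(avg) - f(xstar)) <= D^2, so everything
   rests on a lower bound for the sum of the stepsizes. A stepsize given by the local curvature obeys
   4 lam_k (L0 + L1 |grad f(x_k)|) >= exp(- L1 |x_k - x_(k-1)|), that is, p_k + 4 b_k >= nu with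
   p_k = 4 L0 lam_k and b_k = L1 |x_(k+1) - x_k|, unless the last step was longer than nu / L1.
   Keeping in the energy both the squared step lengths and the quadratic term
   nu |grad f(x_k)|^2 / (2 (L0 + L1 |grad f(x_k)|)) of the convexity inequality at xstar bounds
   sum_k (b_(k-1)^2 + 8 nu b_k^2 / (p_k + 4 b_k)) by 2 (L1 D)^2. The second summand, through the
   Cauchy-Schwarz inequality, pays for the losses 4 b_k; the first one pays for the long steps and for
   the growth steps needed to recover from them. *)

theory Submission
  imports Defs
begin

subsection \<open>Gradient growth of symmetrically smooth convex functions\<close>

locale sym_smooth_convex =
  fixes f :: "'a::euclidean_space \<Rightarrow> real" and L0 L1 :: real and xstar :: 'a
  assumes L0_pos: "L0 > 0" and L1_nonneg: "L1 \<ge> 0"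
    and diff: "\<And>y. f differentiable (at y)"
    and convex: "convex_on UNIV f"
    and smooth: "sym_smooth L0 L1 f"
    and minimizer: "\<And>y. f xstar \<le> f y"
begin

lemma above_tangent: "f x + grad f x \<bullet> (y - x) \<le> f y"
  using convex convex_on_UNIV_iff_grad[OF diff] by auto

lemma has_derivative_f: "(f has_derivative (\<lambda>h. h \<bullet> grad f x)) (at x)"
  using GDERIV_grad[OF diff, of x] by (simp add: gderiv_def)

lemma continuous_on_f: "continuous_on S f"
  using has_derivative_f has_derivative_continuous continuous_at_imp_continuous_on by blast

lemma grad_minimizer [simp]: "grad f xstar = 0"
proof -
  have "(\<lambda>h. h \<bullet> grad f xstar) = (\<lambda>h. 0)"
    by (rule has_derivative_local_min[OF has_derivative_f]) (simp add: minimizer)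
  from fun_cong[OF this, of "grad f xstar"] show ?thesis by simp
qed

text \<open>By convexity, a unit move along the normalised gradient raises \<open>f\<close> by at
  least the gradient norm, and \<open>f\<close> is bounded on balls by continuity. This makes
  suprema of gradient norms over segments finite.\<close>

lemma bounded_grad_image:
  assumes "bounded S"
  shows "bounded (grad f ` S)"
proof -
  obtain R where R: "\<And>u. u \<in> S \<Longrightarrow> norm u \<le> R"
    using assms by (auto simp: bounded_iff)
  have "bounded (f ` cball 0 (R + 1))"
    by (intro compact_imp_bounded compact_continuous_image continuous_on_f compact_cball)
  then obtain B where B: "\<And>v. norm v \<le> R + 1 \<Longrightarrow> \<bar>f v\<bar> \<le> B"
    unfolding bounded_iff by (metis imageI mem_cball_0 real_norm_def)
  have "norm (grad f u) \<le> 2 * B" if "u \<in> S" for u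
  proof -
    define h where "h = sgn (grad f u)"
    have "norm h \<le> 1" by (simp add: h_def norm_sgn)
    with R[OF that] norm_triangle_ineq[of u h]
    have "norm (u + h) \<le> R + 1" "norm u \<le> R + 1" by linarith+
    from B[OF this(1)] B[OF this(2)] have "f (u + h) - f u \<le> 2 * B" by linarith
    moreover have "grad f u \<bullet> h = norm (grad f u)"
      by (cases "grad f u = 0")
        (simp_all add: h_def sgn_div_norm power2_norm_eq_inner[symmetric] power2_eq_square)
    ultimately show ?thesis using above_tangent[of u "u + h"] by simp
  qed
  then show ?thesis by (auto simp: bounded_iff)
qed

text \<open>Replaces the extended-real supremum by any real bound \<open>B\<close> for the local
  weight on the segment.\<close>

lemma grad_diff_le:
  assumes B: "\<And>w. w \<in> closed_segment u v \<Longrightarrow> L0 + L1 * norm (grad f w) \<le> B"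
  shows "norm (grad f u - grad f v) \<le> B * norm (u - v)"
proof -
  let ?S = "SUP w\<in>closed_segment u v. ereal (norm (grad f w))"
  have "ereal L0 + ereal L1 * ?S \<le> ereal B"
  proof (cases "L1 = 0")
    case True
    then show ?thesis using B[of u] by (simp flip: zero_ereal_def)
  next
    case False
    then have pos: "L1 > 0" using L1_nonneg by simp
    have "?S \<le> ereal ((B - L0) / L1)"
    proof (rule SUP_least)
      fix w assume "w \<in> closed_segment u v"
      from B[OF this] pos show "ereal (norm (grad f w)) \<le> ereal ((B - L0) / L1)"
        by (simp add: field_simps)
    qed
    then have "ereal L1 * ?S \<le> ereal L1 * ereal ((B - L0) / L1)"
      using pos by (intro ereal_mult_left_mono) auto
    then have "ereal L0 + ereal L1 * ?S \<le> ereal L0 + ereal L1 * ereal ((B - L0) / L1)"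
      by (rule add_left_mono)
    also have "\<dots> = ereal B" using pos by simp
    finally show ?thesis .
  qed
  then have "(ereal L0 + ereal L1 * ?S) * ereal (norm (u - v)) \<le> ereal B * ereal (norm (u - v))"
    by (intro ereal_mult_right_mono) auto
  moreover have "ereal (norm (grad f u - grad f v))
      \<le> (ereal L0 + ereal L1 * ?S) * ereal (norm (u - v))"
    using smooth unfolding sym_smooth_def by blast
  ultimately have "ereal (norm (grad f u - grad f v)) \<le> ereal B * ereal (norm (u - v))"
    by order
  then show ?thesis by simp
qed

text \<open>The supremum \<open>s\<close> of the weight over the segment bounds itself: smoothness
  between its points and \<open>v\<close> gives
  \<open>s \<le> \<psi> v + L1 * (s * norm (u - v))\<close>.\<close>

lemma grad_growth_step:
  "(L0 + L1 * norm (grad f u)) * (1 - L1 * norm (u - v)) \<le> L0 + L1 * norm (grad f v)"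
proof -
  define \<psi> where "\<psi> w = L0 + L1 * norm (grad f w)" for w
  define s where "s = (SUP w\<in>closed_segment u v. \<psi> w)"
  have "bounded (grad f ` closed_segment u v)"
    by (intro bounded_grad_image bounded_closed_segment)
  then obtain B where "\<And>w. w \<in> closed_segment u v \<Longrightarrow> norm (grad f w) \<le> B"
    by (auto simp: bounded_iff)
  then have "\<psi> w \<le> L0 + L1 * B" if "w \<in> closed_segment u v" for w
    using that L1_nonneg by (simp add: \<psi>_def mult_left_mono)
  then have bdd: "bdd_above (\<psi> ` closed_segment u v)"
    by (auto intro!: bdd_aboveI2)
  have le_s: "\<psi> w \<le> s" if "w \<in> closed_segment u v" for w
    unfolding s_def by (rule cSUP_upper[OF that bdd])
  have \<psi>_pos: "\<psi> w > 0" for w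
    using L0_pos L1_nonneg by (simp add: \<psi>_def add_pos_nonneg)
  have s_pos: "s > 0"
    using le_s[of u] \<psi>_pos[of u] by simp
  have "\<psi> w \<le> \<psi> v + L1 * (s * norm (u - v))" if w: "w \<in> closed_segment u v" for w
  proof -
    have "norm (grad f w - grad f v) \<le> s * norm (w - v)"
    proof (rule grad_diff_le)
      fix w' assume "w' \<in> closed_segment w v"
      moreover have "closed_segment w v \<subseteq> closed_segment u v"
        using w by (simp add: subset_closed_segment)
      ultimately show "L0 + L1 * norm (grad f w') \<le> s"
        using le_s[of w'] by (auto simp: \<psi>_def)
    qed
    also have "\<dots> \<le> s * norm (u - v)"
      using s_pos segment_bound(2)[OF w] by (intro mult_left_mono) (auto simp: norm_minus_commute)
    finally have "norm (grad f w) \<le> norm (grad f v) + s * norm (u - v)"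
      using norm_triangle_ineq2[of "grad f w" "grad f v"] by linarith
    from mult_left_mono[OF this L1_nonneg] show ?thesis
      by (simp add: \<psi>_def algebra_simps)
  qed
  then have "s \<le> \<psi> v + L1 * (s * norm (u - v))"
    unfolding s_def by (intro cSUP_least) auto
  then have s_le: "s * (1 - L1 * norm (u - v)) \<le> \<psi> v"
    by (simp add: algebra_simps)
  have "\<psi> u * (1 - L1 * norm (u - v)) \<le> \<psi> v"
  proof (cases "1 - L1 * norm (u - v) \<ge> 0")
    case True
    then have "\<psi> u * (1 - L1 * norm (u - v)) \<le> s * (1 - L1 * norm (u - v))"
      using le_s[of u] by (intro mult_right_mono) auto
    with s_le show ?thesis by simp
  next
    case False
    then have "\<psi> u * (1 - L1 * norm (u - v)) \<le> 0"
      using \<psi>_pos[of u] by (intro mult_nonneg_nonpos) auto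
    then show ?thesis using \<psi>_pos[of v] by simp
  qed
  then show ?thesis by (simp add: \<psi>_def)
qed

text \<open>A discrete Gronwall argument: apply the one-step bound on \<open>n\<close> equal pieces of the segment and
  let \<open>n\<close> tend to infinity.\<close>

lemma grad_growth:
  "L0 + L1 * norm (grad f u) \<le> (L0 + L1 * norm (grad f v)) * exp (L1 * norm (u - v))"
proof -
  define \<psi> where "\<psi> w = L0 + L1 * norm (grad f w)" for w
  define c where "c = L1 * norm (u - v)"
  have c_nonneg: "c \<ge> 0" using L1_nonneg by (simp add: c_def)
  have "\<psi> u * (1 + (- c) / real n) ^ n \<le> \<psi> v" if n: "n \<ge> 1" "real n \<ge> c" for n
  proof -
    define w where "w i = v + (real i / real n) *\<^sub>R (u - v)" for i
    have nn: "1 + (- c) / real n \<ge> 0"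
      using n by (simp add: field_simps)
    have "\<psi> (w i) * (1 + (- c) / real n) ^ i \<le> \<psi> v" for i
    proof (induction i)
      case (Suc i)
      have "w (Suc i) - w i = (1 / real n) *\<^sub>R (u - v)"
        by (simp add: w_def scaleR_diff_left[symmetric] diff_divide_distrib[symmetric])
      then have "norm (w (Suc i) - w i) = norm (u - v) / real n"
        by simp
      then have "\<psi> (w (Suc i)) * (1 + (- c) / real n) \<le> \<psi> (w i)"
        using grad_growth_step[of "w (Suc i)" "w i"] by (simp add: \<psi>_def c_def)
      from mult_right_mono[OF this zero_le_power[OF nn, of i]] Suc show ?case
        by (simp add: algebra_simps)
    qed (simp add: w_def)
    from this[of n] n show ?thesis by (simp add: w_def)
  qed
  note pieces = this
  have "\<forall>\<^sub>F n in sequentially. \<psi> u * (1 + (- c) / real n) ^ n \<le> \<psi> v"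
    using eventually_ge_at_top[of 1] eventually_ge_at_top[of "nat \<lceil>c\<rceil>"]
  proof eventually_elim
    case (elim n)
    with real_nat_ceiling_ge[of c] have "real n \<ge> c" by linarith
    with elim pieces[of n] show ?case by simp
  qed
  moreover have "(\<lambda>n. \<psi> u * (1 + (- c) / real n) ^ n) \<longlonglongrightarrow> \<psi> u * exp (- c)"
    by (intro tendsto_intros tendsto_exp_limit_sequentially)
  ultimately have "\<psi> u * exp (- c) \<le> \<psi> v"
    by (intro tendsto_upperbound) auto
  then have "\<psi> u * exp (- c) * exp c \<le> \<psi> v * exp c"
    by (intro mult_right_mono) auto
  then show ?thesis by (simp add: \<psi>_def c_def mult.assoc exp_minus)
qed

text \<open>Every point of the segment lies within \<open>norm (u - v)\<close> of \<open>u\<close>,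
  so growth measured from \<open>u\<close> alone suffices; in the stepsize bound \<open>u\<close> is
  the newer iterate.\<close>

lemma grad_diff_le_exp:
  "norm (grad f u - grad f v)
    \<le> (L0 + L1 * norm (grad f u)) * exp (L1 * norm (u - v)) * norm (u - v)"
proof (rule grad_diff_le)
  fix w assume w: "w \<in> closed_segment u v"
  have pos: "L0 + L1 * norm (grad f u) \<ge> 0"
    using L0_pos L1_nonneg by (simp add: add_nonneg_nonneg)
  have "norm (w - u) \<le> norm (u - v)"
    using segment_bound(1)[OF w] by (simp add: norm_minus_commute)
  then have "exp (L1 * norm (w - u)) \<le> exp (L1 * norm (u - v))"
    using L1_nonneg by (simp add: mult_left_mono)
  from mult_left_mono[OF this pos] grad_growth[of w u]
  show "L0 + L1 * norm (grad f w) \<le> (L0 + L1 * norm (grad f u)) * exp (L1 * norm (u - v))"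
    by linarith
qed

text \<open>The weight at \<open>xstar\<close> is only \<open>L0\<close>, so growth from there
  bounds it on the whole ball, which contains the segment.\<close>

lemma grad_diff_le_near_minimizer:
  assumes "norm (u - xstar) \<le> R" "norm (v - xstar) \<le> R"
  shows "norm (grad f u - grad f v) \<le> L0 * exp (L1 * R) * norm (u - v)"
proof (rule grad_diff_le)
  fix w assume w: "w \<in> closed_segment u v"
  have "closed_segment u v \<subseteq> cball xstar R"
    using assms by (intro closed_segment_subset) (auto simp: dist_norm norm_minus_commute)
  with w have "norm (w - xstar) \<le> R"
    by (auto simp: dist_norm norm_minus_commute)
  then have "exp (L1 * norm (w - xstar)) \<le> exp (L1 * R)"
    using L1_nonneg by (simp add: mult_left_mono)
  then have "L0 * exp (L1 * norm (w - xstar)) \<le> L0 * exp (L1 * R)"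
    using L0_pos by simp
  with grad_growth[of w xstar]
  show "L0 + L1 * norm (grad f w) \<le> L0 * exp (L1 * R)" by simp
qed

lemma minimizer_growth:
  "f (xstar + v) - f xstar \<le> L0 * exp (L1 * norm v) * (norm v)\<^sup>2 / 2"
proof -
  define B where "B = L0 * exp (L1 * norm v)"
  define h where "h s = f (xstar + s *\<^sub>R v) - B * (norm v)\<^sup>2 * s\<^sup>2 / 2" for s
  have "h 1 \<le> h 0"
  proof (rule DERIV_nonpos_imp_nonincreasing[of 0 1 h])
    fix s :: real assume s: "0 \<le> s" "s \<le> 1"
    have "((\<lambda>s. f (xstar + s *\<^sub>R v)) has_derivative
        (\<lambda>t. (t *\<^sub>R v) \<bullet> grad f (xstar + s *\<^sub>R v))) (at s)"
      by (rule has_derivative_compose[OF _ has_derivative_f]) (auto intro!: derivative_eq_intros)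
    then have "((\<lambda>s. f (xstar + s *\<^sub>R v)) has_real_derivative
        grad f (xstar + s *\<^sub>R v) \<bullet> v) (at s)"
      unfolding has_field_derivative_def
      by (rule has_derivative_eq_rhs) (simp add: fun_eq_iff inner_commute)
    then have "(h has_real_derivative
        grad f (xstar + s *\<^sub>R v) \<bullet> v - B * (norm v)\<^sup>2 * s) (at s)"
      unfolding h_def by (auto intro!: derivative_eq_intros)
    moreover have "grad f (xstar + s *\<^sub>R v) \<bullet> v \<le> B * (norm v)\<^sup>2 * s"
    proof -
      have "norm (s *\<^sub>R v) \<le> norm v"
        using s by (simp add: mult_left_le_one_le)
      then have "norm (grad f (xstar + s *\<^sub>R v)) \<le> B * (s * norm v)"
        using grad_diff_le_near_minimizer[of "xstar + s *\<^sub>R v" "norm v" xstar] s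
        by (simp add: B_def)
      then have "norm (grad f (xstar + s *\<^sub>R v)) * norm v \<le> B * (s * norm v) * norm v"
        by (intro mult_right_mono) auto
      with norm_cauchy_schwarz[of "grad f (xstar + s *\<^sub>R v)" v] show ?thesis
        by (simp add: power2_eq_square algebra_simps)
    qed
    ultimately show "\<exists>y. (h has_real_derivative y) (at s) \<and> y \<le> 0"
      by (intro exI conjI) auto
  qed simp
  then show ?thesis by (simp add: h_def B_def)
qed

text \<open>Compare the tangent at \<open>x\<close> with \<open>f\<close> at the point \<open>xstar + \<eta> *\<^sub>R grad f x\<close>; the step
  \<open>\<eta> = \<nu> / (L0 + L1 * norm (grad f x))\<close> keeps the exponential in the growth bound below \<open>1 / \<nu>\<close>.\<close>

lemma minimizer_gap:
  assumes \<nu>: "\<nu> = exp (- \<nu>)"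
  shows "f x - f xstar + \<nu> * (norm (grad f x))\<^sup>2 / (2 * (L0 + L1 * norm (grad f x)))
    \<le> grad f x \<bullet> (x - xstar)"
proof -
  define a where "a = norm (grad f x)"
  define \<eta> where "\<eta> = \<nu> / (L0 + L1 * a)"
  have a: "a \<ge> 0" by (simp add: a_def)
  have \<nu>_pos: "\<nu> > 0" using \<nu> exp_gt_zero[of "- \<nu>"] by simp
  have pos: "L0 + L1 * a > 0" using L0_pos L1_nonneg a by (simp add: add_pos_nonneg)
  have \<eta>_pos: "\<eta> > 0" using \<nu>_pos pos by (simp add: \<eta>_def)
  have eq: "\<eta> * (L0 + L1 * a) = \<nu>" using pos by (simp add: \<eta>_def)
  have nv: "norm (\<eta> *\<^sub>R grad f x) = \<eta> * a" using \<eta>_pos by (simp add: a_def)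
  have "L1 * (\<eta> * a) \<le> \<nu>"
    using eq \<eta>_pos L0_pos by (simp add: algebra_simps) (smt (verit) mult_pos_pos)
  then have "exp (L1 * (\<eta> * a)) \<le> exp \<nu>" by simp
  also have "exp \<nu> = 1 / \<nu>" using \<nu> by (metis exp_minus inverse_eq_divide inverse_inverse_eq)
  finally have ex: "exp (L1 * (\<eta> * a)) \<le> 1 / \<nu>" .
  \<comment> \<open>This \<open>\<nu>\<close> cancels the \<open>1 / \<nu>\<close> from the
    exponential, so the curvature term costs at most half of the linear gain
    \<open>\<eta> * a\<^sup>2\<close>.\<close>
  have "L0 * \<eta> \<le> \<nu>"
    using eq \<eta>_pos L1_nonneg a by (simp add: algebra_simps) (smt (verit) mult_nonneg_nonneg)
  then have "L0 * \<eta> * (1 / \<nu>) \<le> 1" using \<nu>_pos by simp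
  moreover have "L0 * \<eta> * exp (L1 * (\<eta> * a)) \<le> L0 * \<eta> * (1 / \<nu>)"
    using ex L0_pos \<eta>_pos by (intro mult_left_mono) auto
  ultimately have "L0 * \<eta> * exp (L1 * (\<eta> * a)) \<le> 1" by linarith
  then have "L0 * \<eta> * exp (L1 * (\<eta> * a)) * (\<eta> * a\<^sup>2 / 2) \<le> 1 * (\<eta> * a\<^sup>2 / 2)"
    using \<eta>_pos by (intro mult_right_mono) auto
  moreover have "f (xstar + \<eta> *\<^sub>R grad f x) - f xstar
      \<le> L0 * exp (L1 * (\<eta> * a)) * (\<eta> * a)\<^sup>2 / 2"
    using minimizer_growth[of "\<eta> *\<^sub>R grad f x"] nv by simp
  ultimately have 1: "f (xstar + \<eta> *\<^sub>R grad f x) - f xstar \<le> \<eta> * a\<^sup>2 / 2"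
    by (simp add: power2_eq_square algebra_simps)
  have "grad f x \<bullet> (xstar + \<eta> *\<^sub>R grad f x - x) = \<eta> * a\<^sup>2 - grad f x \<bullet> (x - xstar)"
    by (simp add: a_def power2_norm_eq_inner algebra_simps)
  with above_tangent[of x "xstar + \<eta> *\<^sub>R grad f x"] 1
  have "f x - f xstar + \<eta> * a\<^sup>2 / 2 \<le> grad f x \<bullet> (x - xstar)" by simp
  then show ?thesis by (simp add: \<eta>_def a_def mult.commute)
qed

end

subsection \<open>Amortised lower bound for the stepsizes\<close>

locale omega_constant =
  fixes \<nu> :: real
  assumes nu_eq: "\<nu> = exp (- \<nu>)"
begin

text \<open>\<open>\<nu>\<close> is the omega constant, about 0.567. As \<open>exp (- t)\<close>
  decreases, any \<open>t\<close> with \<open>exp (- t) > t\<close> lies below the fixed point; 16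
  factors approximate the exponential closely enough.\<close>

lemma nu_gt: "\<nu> > 56/100"
proof (rule ccontr)
  assume "\<not> \<nu> > 56/100"
  then have "exp (- (56/100)) \<le> \<nu>"
    by (subst nu_eq) simp
  moreover have "(1 - (56/100) / of_nat 16) ^ 16 \<le> exp (- (56/100) :: real)"
    by (rule exp_ge_one_minus_x_over_n_power_n) auto
  moreover have "(56/100 :: real) < (1 - (56/100) / of_nat 16) ^ 16"
    by (simp add: field_simps)
  ultimately show False using \<open>\<not> \<nu> > 56/100\<close> by linarith
qed

lemma nu_less: "\<nu> < 575/1000"
proof (rule ccontr)
  assume neg: "\<not> \<nu> < 575/1000"
  then have "exp (575/1000) \<le> exp \<nu>" by simp
  moreover have "1 + 575/1000 + (575/1000)\<^sup>2 / 2 \<le> exp (575/1000 :: real)"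
    by (rule exp_lower_Taylor_quadratic) simp
  moreover have "(1740/1000 :: real) \<le> 1 + 575/1000 + (575/1000)\<^sup>2 / 2"
    by (simp add: power2_eq_square)
  ultimately have "1740/1000 \<le> exp \<nu>" by linarith
  then have "1740/1000 * \<nu> \<le> exp \<nu> * exp (- \<nu>)"
    using nu_eq neg by (metis mult_right_mono exp_ge_zero)
  then show False using neg by (simp flip: exp_add)
qed

text \<open>The slope \<open>16/3 = 4 / (3/4)\<close> allows for one growth step, which keeps at
  least \<open>3/4\<close> of \<open>b\<close>. With \<open>e = p + 4 * b\<close> and
  \<open>M = 2\<close>, the gain is at least \<open>16/3 * b\<close> if
  \<open>e \<le> \<nu>\<close>; otherwise it is at least \<open>4 * b / sqrt e\<close>, which lifts
  the sum to \<open>e\<close> if \<open>e \<le> 1\<close> and to 1 if not.\<close>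

lemma good_step_gain:
  assumes p: "p > 0" and b: "b \<ge> 0" and pb: "p + 16/3 * b \<ge> \<nu>" and M: "M \<ge> 2"
  shows "p + M * (sqrt (8 * \<nu>) * b / sqrt (p + 4 * b)) \<ge> \<nu>"
proof -
  define e where "e = p + 4 * b"
  have e: "e > 0" using p b by (simp add: e_def)
  have key: "p + 2 * (sqrt (8 * \<nu>) * b / sqrt e) \<ge> \<nu>"
  proof (cases "e \<le> \<nu>")
    case True
    have "sqrt e * sqrt 8 \<le> sqrt (8 * \<nu>)"
      using True by (simp flip: real_sqrt_mult)
    then have "sqrt 8 \<le> sqrt (8 * \<nu>) / sqrt e"
      using e by (simp add: field_simps)
    moreover have "sqrt 8 \<ge> 8/3"
      by (rule real_le_rsqrt) (simp add: power2_eq_square)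
    ultimately have "8/3 \<le> sqrt (8 * \<nu>) / sqrt e" by linarith
    then have "8/3 * b \<le> sqrt (8 * \<nu>) / sqrt e * b"
      using b by (intro mult_right_mono) auto
    then show ?thesis using pb by simp
  next
    case False
    have "sqrt (8 * \<nu>) \<ge> 2"
      using nu_gt by (intro real_le_rsqrt) simp
    then have "2 * (b / sqrt e) \<le> sqrt (8 * \<nu>) * (b / sqrt e)"
      using b e by (intro mult_right_mono) auto
    then have gain: "4 * b / sqrt e \<le> 2 * (sqrt (8 * \<nu>) * b / sqrt e)"
      by simp
    show ?thesis
    proof (cases "e \<le> 1")
      case True
      then have "sqrt e \<le> 1" by simp
      then have "4 * b \<le> 4 * b / sqrt e"
        using b e by (simp add: field_simps mult_left_le)
      then show ?thesis using gain False by (simp add: e_def)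
    next
      case gt: False
      then have s: "sqrt e \<ge> 1" by simp
      have "sqrt e = p / sqrt e + 4 * b / sqrt e"
        using e by (simp add: e_def flip: add_divide_distrib) (simp add: real_div_sqrt)
      moreover have "p / sqrt e \<le> p"
        using s p by (simp add: field_simps)
      ultimately have "1 \<le> p + 4 * b / sqrt e" using s by linarith
      then show ?thesis using gain nu_less by linarith
    qed
  qed
  have "2 * (sqrt (8 * \<nu>) * b / sqrt e) \<le> M * (sqrt (8 * \<nu>) * b / sqrt e)"
    using M b e nu_gt by (intro mult_right_mono) auto
  then show ?thesis using key by (simp add: e_def)
qed

text \<open>The constant \<open>153/100\<close> is an upper bound for \<open>sqrt (7/3)\<close>: all iterates, including \<open>x 0\<close>, lie within
  \<open>sqrt (7/3) * D\<close> of the minimizer.\<close>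

lemma recovery_factor:
  assumes A: "A \<ge> 0" and large: "3/4 * \<nu>\<^sup>2 < A\<^sup>2"
  shows "\<nu> \<le> real_of_int \<lceil>(1 + A * exp (2 * A)) / 2\<rceil> * exp (- (153/100 * A))"
proof -
  define C where "C = real_of_int \<lceil>(1 + A * exp (2 * A)) / 2\<rceil>"
  have C_ge: "C \<ge> (1 + A * exp (2 * A)) / 2" by (simp add: C_def)
  have "(56/100)\<^sup>2 < \<nu>\<^sup>2"
    using nu_gt by (intro power_strict_mono) auto
  then have "(48/100)\<^sup>2 < A\<^sup>2" using large by (simp add: power2_eq_square)
  then have A48: "48/100 < A" using A by (rule power_less_imp_less_base)
  have "\<nu> * exp (153/100 * A) \<le> C"
  \<comment> \<open>For small \<open>A\<close> the rounding is used: the quotient exceeds 1, so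
    \<open>C \<ge> 2\<close>, while \<open>153/100 * A - \<nu> \<le> 2/3 \<le> ln 2\<close>. For
    larger \<open>A\<close>, splitting \<open>exp (47/100 * A)\<close> off
    \<open>exp (2 * A)\<close> suffices, as \<open>A * exp (47/100 * A) / 2\<close> exceeds
    \<open>\<nu>\<close>.\<close>
  proof (cases "A \<le> 8/10")
    case True
    have "1 + 96/100 + (96/100)\<^sup>2 / 2 \<le> exp (96/100 :: real)"
      by (rule exp_lower_Taylor_quadratic) simp
    also have "\<dots> \<le> exp (2 * A)" using A48 by simp
    finally have "24/10 \<le> exp (2 * A)" by (simp add: power2_eq_square)
    with A48 have "48/100 * (24/10) \<le> A * exp (2 * A)" by (intro mult_mono) auto
    then have "(1 + A * exp (2 * A)) / 2 > 1" by simp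
    then have "\<lceil>(1 + A * exp (2 * A)) / 2\<rceil> \<ge> 2" by linarith
    then have "C \<ge> 2" by (simp add: C_def)
    moreover have "\<nu> * exp (153/100 * A) \<le> 2"
    proof -
      have "\<nu> * exp (153/100 * A) = exp (153/100 * A - \<nu>)"
        by (subst nu_eq) (simp flip: exp_add)
      also have "\<dots> \<le> exp (ln 2)"
        using True nu_gt ln2_ge_two_thirds by (subst exp_le_cancel_iff) linarith
      finally show ?thesis by simp
    qed
    ultimately show ?thesis by simp
  next
    case False
    have "1 + 376/1000 + (376/1000)\<^sup>2 / 2 \<le> exp (376/1000 :: real)"
      by (rule exp_lower_Taylor_quadratic) simp
    also have "\<dots> \<le> exp (47/100 * A)" using False by simp
    finally have "144/100 \<le> exp (47/100 * A)" by (simp add: power2_eq_square)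
    with False have "8/10 * (144/100) \<le> A * exp (47/100 * A)" by (intro mult_mono) auto
    then have "\<nu> * exp (153/100 * A) \<le> A * exp (47/100 * A) / 2 * exp (153/100 * A)"
      using nu_less by (intro mult_right_mono) auto
    also have "\<dots> = A * exp (2 * A) / 2"
      by (simp add: mult.assoc flip: exp_add)
    finally show ?thesis using C_ge by simp
  qed
  then have "\<nu> * exp (153/100 * A) * exp (- (153/100 * A)) \<le> C * exp (- (153/100 * A))"
    by (intro mult_right_mono) auto
  then show ?thesis by (simp add: C_def mult.assoc flip: exp_add)
qed

text \<open>Bookkeeping behind the sum of the stepsizes. A step is either a curvature step or a growth step,
  in which the ratio is \<open>sqrt (1 + \<theta> (k - 1)) \<ge> 1\<close>. After a curvature step with \<open>b (k - 1) \<le> \<nu>\<close>, that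
  step and all growth steps up to the next curvature step satisfy \<open>p k + gain k \<ge> \<nu>\<close>.
  A curvature step with \<open>b (k - 1) > \<nu>\<close> gains at least
  \<open>m * \<nu>\<close>, a credit that covers the \<open>m\<close> steps (one of them fractional) which \<open>p\<close>, growing at rate
  \<open>sqrt 2\<close>, needs to climb from \<open>c\<close> to \<open>\<nu>\<close>; \<open>bad n i\<close> says that \<open>i\<close> growth steps have followed it.\<close>

lemma amortised_stepsizes:
  fixes p b \<theta> :: "nat \<Rightarrow> real" and m c :: real
  defines "gain k \<equiv> (m + 1) * (sqrt (8 * \<nu>) * b k / sqrt (p k + 4 * b k)) + m / \<nu> * (b (k - 1))\<^sup>2"
  assumes m: "m \<ge> 1" and c: "c \<ge> 0"
    and p: "\<And>k. p k > 0" and b: "\<And>k. b k \<ge> 0" and \<theta>: "\<And>k. k \<ge> 1 \<Longrightarrow> \<theta> k > 0"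
    and dichotomy: "\<And>k. k \<ge> 1 \<Longrightarrow>
       (exp (- b (k - 1)) \<le> p k + 4 * b k \<and> c \<le> p k) \<or>
       (k \<ge> 2 \<and> \<theta> k = sqrt (1 + \<theta> (k - 1)) \<and> p k = \<theta> k * p (k - 1)
         \<and> (\<theta> k - 1/4) * b (k - 1) \<le> b k)"
    and recovery: "\<And>k. k \<ge> 1 \<Longrightarrow> \<nu> < b (k - 1) \<Longrightarrow> \<nu> \<le> sqrt 2 powr (m - 1) * c"
    and N: "N \<ge> 1"
  shows "\<nu> * real N \<le> (\<Sum>k=1..N. p k + gain k)"
proof -
  define T where "T n = (\<Sum>k=1..n. p k + gain k - \<nu>)" for n
  have \<nu>_pos: "\<nu> > 0" using nu_gt by simp
  have z_nonneg: "sqrt (8 * \<nu>) * b k / sqrt (p k + 4 * b k) \<ge> 0" for k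
    using p[of k] b[of k] \<nu>_pos by simp
  have gain_nonneg: "gain k \<ge> 0" for k
    unfolding gain_def using m \<nu>_pos z_nonneg[of k]
    by (intro add_nonneg_nonneg mult_nonneg_nonneg) auto
  have T_Suc: "T (Suc n) = T n + (p (Suc n) + gain (Suc n) - \<nu>)" for n
    by (simp add: T_def)
  have good_gain: "p k + gain k \<ge> \<nu>" if "p k + 16/3 * b k \<ge> \<nu>" for k
  proof -
    have "(m / \<nu>) * (b (k - 1))\<^sup>2 \<ge> 0" using m \<nu>_pos by simp
    then show ?thesis
      using good_step_gain[OF p b that, of "m + 1"] m by (simp add: gain_def)
  qed
  define bad where "bad n i \<longleftrightarrow>
      \<nu> \<le> sqrt 2 powr (m - 1) * c \<and> c \<le> p n \<and> \<nu> * (m - 1 - real i) \<le> T n \<and>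
      (i = 0 \<or> \<theta> n \<ge> 1 \<and> sqrt 2 powr (real i - 1) * c \<le> p n)" for n i
  \<comment> \<open>The second alternative loses nothing in further growth steps:
    \<open>\<theta> n \<ge> 1\<close> forces the next ratio to be at least \<open>sqrt 2\<close>,
    and \<open>sqrt 2 - 1/4 \<ge> 1\<close>.\<close>
  define state where "state n \<longleftrightarrow>
      \<nu> \<le> p n + 4 * b n \<or> (\<nu> \<le> p n + 16/3 * b n \<and> \<theta> n \<ge> 1) \<or> (\<exists>i. bad n i)" for n
  have curvature: "T (Suc n) \<ge> 0 \<and> state (Suc n)"
    if T: "T n \<ge> 0" and e: "exp (- b n) \<le> p (Suc n) + 4 * b (Suc n)" and cp: "c \<le> p (Suc n)" for n
  proof (cases "b n \<le> \<nu>")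
    case True
    then have "\<nu> \<le> exp (- b n)" by (subst nu_eq) simp
    with e have good: "\<nu> \<le> p (Suc n) + 4 * b (Suc n)" by simp
    then have "\<nu> \<le> p (Suc n) + 16/3 * b (Suc n)" using b[of "Suc n"] by simp
    from good_gain[OF this] T good show ?thesis by (simp add: T_Suc state_def)
  next
    case False
    then have "\<nu>\<^sup>2 \<le> (b n)\<^sup>2" using \<nu>_pos by (intro power_mono) auto
    then have "m / \<nu> * \<nu>\<^sup>2 \<le> m / \<nu> * (b n)\<^sup>2"
      using m \<nu>_pos by (intro mult_left_mono) auto
    moreover have "m / \<nu> * \<nu>\<^sup>2 = m * \<nu>" using \<nu>_pos by (simp add: power2_eq_square)
    moreover have "(m + 1) * (sqrt (8 * \<nu>) * b (Suc n) / sqrt (p (Suc n) + 4 * b (Suc n))) \<ge> 0"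
      using m z_nonneg[of "Suc n"] by (intro mult_nonneg_nonneg) auto
    ultimately have "m * \<nu> \<le> gain (Suc n)" by (simp add: gain_def)
    \<comment> \<open>The long step earned \<open>m * \<nu>\<close>; paying the current target
      leaves \<open>m - 1\<close> units.\<close>
    then have T': "\<nu> * (m - 1) \<le> T (Suc n)"
      using T p[of "Suc n"] by (simp add: T_Suc algebra_simps)
    moreover have "\<nu> * (m - 1) \<ge> 0" using m \<nu>_pos by simp
    moreover have "bad (Suc n) 0"
      using T' cp recovery[of "Suc n"] False by (simp add: bad_def)
    ultimately show ?thesis by (auto simp: state_def)
  qed
  have growth: "T (Suc n) \<ge> 0 \<and> state (Suc n)"
    if n: "n \<ge> 1" and T: "T n \<ge> 0" and st: "state n"
      and th: "\<theta> (Suc n) = sqrt (1 + \<theta> n)" and pS: "p (Suc n) = \<theta> (Suc n) * p n"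
      and bS: "(\<theta> (Suc n) - 1/4) * b n \<le> b (Suc n)" for n
  proof -
    have th1: "\<theta> (Suc n) \<ge> 1" using \<theta>[OF n] by (simp add: th)
    have p_le: "p n \<le> p (Suc n)" using th1 p[of n] by (simp add: pS)
    have "3/4 * b n \<le> (\<theta> (Suc n) - 1/4) * b n"
      using th1 b[of n] by (intro mult_right_mono) auto
    then have b34: "3/4 * b n \<le> b (Suc n)" using bS by simp
    have th2: "sqrt 2 \<le> \<theta> (Suc n)" if "\<theta> n \<ge> 1" using that by (simp add: th)
    consider "\<nu> \<le> p n + 4 * b n" | "\<nu> \<le> p n + 16/3 * b n" "\<theta> n \<ge> 1" | i where "bad n i"
      using st by (auto simp: state_def)
    then show ?thesis
    proof cases
      case 1
      then have good: "\<nu> \<le> p (Suc n) + 16/3 * b (Suc n)" using p_le b34 by simp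
      from good_gain[OF this] T good th1 show ?thesis by (simp add: T_Suc state_def)
    next
      case 2
      have "sqrt 2 \<ge> 5/4" by (rule real_le_rsqrt) (simp add: power2_eq_square)
      with th2[OF 2(2)] have "1 * b n \<le> (\<theta> (Suc n) - 1/4) * b n"
        using b[of n] by (intro mult_right_mono) auto
      with bS 2 p_le have good: "\<nu> \<le> p (Suc n) + 16/3 * b (Suc n)" by simp
      from good_gain[OF this] T good th1 show ?thesis by (simp add: T_Suc state_def)
    next
      case (3 i)
      define \<phi> where "\<phi> = m - 1 - real i"
      \<comment> \<open>The first growth step after the curvature step is only known to have ratio
        at least 1, hence the exponent \<open>i - 1\<close> in \<open>bad\<close>; each later one
        contributes a factor \<open>sqrt 2\<close>.\<close>
      have grown: "sqrt 2 powr real i * c \<le> p (Suc n)"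
      proof (cases "i = 0")
        case True
        then show ?thesis using 3 p_le by (simp add: bad_def)
      next
        case False
        with 3 have i: "\<theta> n \<ge> 1" "sqrt 2 powr (real i - 1) * c \<le> p n" by (auto simp: bad_def)
        have "sqrt 2 powr real i = sqrt 2 * sqrt 2 powr (real i - 1)"
          by (simp add: powr_diff)
        then have "sqrt 2 powr real i * c = sqrt 2 * (sqrt 2 powr (real i - 1) * c)" by simp
        also have "\<dots> \<le> \<theta> (Suc n) * p n"
          using th2[OF i(1)] i(2) c th1 by (intro mult_mono) auto
        finally show ?thesis by (simp add: pS)
      qed
      have credit: "\<nu> * \<phi> \<le> T n" using 3 by (simp add: bad_def \<phi>_def)
      have T': "T n + p (Suc n) - \<nu> \<le> T (Suc n)" using gain_nonneg[of "Suc n"] by (simp add: T_Suc)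
      have credit': "\<nu> * (m - 1 - real (Suc i)) \<le> T (Suc n)"
        using T' credit p[of "Suc n"] by (simp add: \<phi>_def algebra_simps)
      have "T (Suc n) \<ge> 0"
      proof (cases "\<phi> \<ge> 1")
        case True
        then have "\<nu> * 1 \<le> \<nu> * \<phi>" using \<nu>_pos by (intro mult_left_mono) auto
        then show ?thesis using T' credit p[of "Suc n"] by simp
      next
        case False
        have "sqrt 2 powr real i = sqrt 2 powr (m - 1) * sqrt 2 powr (- \<phi>)"
          by (simp add: \<phi>_def flip: powr_add)
        then have "sqrt 2 powr real i * c = (sqrt 2 powr (m - 1) * c) * sqrt 2 powr (- \<phi>)"
          by simp
        moreover have "\<nu> * sqrt 2 powr (- \<phi>) \<le> (sqrt 2 powr (m - 1) * c) * sqrt 2 powr (- \<phi>)"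
          using 3 by (intro mult_right_mono) (auto simp: bad_def)
        ultimately have p_ge: "\<nu> * sqrt 2 powr (- \<phi>) \<le> p (Suc n)" using grown by linarith
        show ?thesis
        proof (cases "\<phi> \<le> 0")
          case True
          then have "sqrt 2 powr (- \<phi>) \<ge> 1" by (intro ge_one_powr_ge_zero) auto
          then have "\<nu> * 1 \<le> \<nu> * sqrt 2 powr (- \<phi>)" using \<nu>_pos by (intro mult_left_mono) auto
          then show ?thesis using p_ge T T' by simp
        next
          case pos: False
          \<comment> \<open>For a fractional credit \<open>0 < \<phi> < 1\<close> the tangent bound
            gives \<open>sqrt 2 powr (- \<phi>) \<ge> 1 - \<phi>\<close>: the stepsize supplies
            \<open>\<nu> * (1 - \<phi>)\<close> and the credit the rest.\<close>
          have "ln (sqrt 2) \<le> (1::real)" using ln_le_minus_one[of "sqrt 2"] sqrt2_less_2 by simp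
          then have "1 - \<phi> \<le> 1 + (- \<phi>) * ln (sqrt 2)" using pos mult_left_le[of "ln (sqrt 2)" \<phi>] by simp
          also have "\<dots> \<le> sqrt 2 powr (- \<phi>)"
            using exp_ge_add_one_self[of "(- \<phi>) * ln (sqrt 2)"] by (simp add: powr_def)
          finally have "\<nu> * (1 - \<phi>) \<le> \<nu> * sqrt 2 powr (- \<phi>)"
            using \<nu>_pos by (intro mult_left_mono) auto
          then show ?thesis using p_ge credit T' by (simp add: algebra_simps)
        qed
      qed
      moreover have "bad (Suc n) (Suc i)"
        using credit' grown th1 3 p_le by (simp add: bad_def)
      ultimately show ?thesis by (auto simp: state_def)
    qed
  qed
  have "T N \<ge> 0 \<and> state N"
    using N
  proof (induction N rule: nat_induct_at_least)
    case base
    show ?case using curvature[of 0] dichotomy[of 1] by (simp add: T_def)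
  next
    case (Suc n)
    then show ?case using curvature[of n] growth[of n] dichotomy[of "Suc n"] by auto
  qed
  then show ?thesis by (simp add: T_def sum_subtractf mult.commute)
qed

end

subsection \<open>The energy inequality\<close>

locale adgd_run = sym_smooth_convex f L0 L1 xstar + omega_constant \<nu>
  for f :: "'a::euclidean_space \<Rightarrow> real" and L0 L1 :: real and xstar :: 'a and \<nu> :: real +
  fixes x :: "nat \<Rightarrow> 'a" and lam theta :: "nat \<Rightarrow> real" and D :: real
  assumes run: "adgd (1/4) f x lam theta"
    and well_defined: "\<And>k. k \<ge> 1 \<Longrightarrow> grad f (x k) \<noteq> grad f (x (k - 1))"
    and D_pos: "D > 0"
    and D_eq: "D\<^sup>2 = (norm (x 1 - xstar))\<^sup>2 + 3/4 * (norm (x 1 - x 0))\<^sup>2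
                + 2 * lam 1 * theta 1 * (f (x 0) - f xstar)"
begin

abbreviation g :: "nat \<Rightarrow> 'a" where "g k \<equiv> grad f (x k)"
definition gap :: "nat \<Rightarrow> real" where "gap k = f (x k) - f xstar"

definition r :: "nat \<Rightarrow> real" where "r k = norm (x (Suc k) - x k)"

text \<open>The term by which \<open>minimizer_gap\<close> at \<open>x k\<close> improves on plain
  convexity.\<close>

definition bonus :: "nat \<Rightarrow> real" where
  "bonus k = \<nu> * (norm (g k))\<^sup>2 / (2 * (L0 + L1 * norm (g k)))"

section \<open>Elementary relations along the run\<close>

lemma iterate: "x (Suc k) = x k - lam k *\<^sub>R g k"
proof (cases k)
  case 0
  then show ?thesis using run unfolding adgd_def by simp
next
  case (Suc n)
  have "\<forall>k\<ge>1. x (k + 1) = x k - lam k *\<^sub>R g k"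
    using run unfolding adgd_def by blast
  from this[rule_format, of k] show ?thesis by (simp add: Suc)
qed

lemma theta_Suc: "theta (Suc k) = lam (Suc k) / lam k"
proof -
  have "\<forall>k\<ge>1. theta k = lam k / lam (k - 1)"
    using run unfolding adgd_def by blast
  from this[rule_format, of "Suc k"] show ?thesis by simp
qed

lemma stepsize:
  fixes k
  defines "q \<equiv> 1/4 * r k / norm (g (Suc k) - g k)"
  shows "lam (Suc k) = (if k = 0 then q else min (sqrt (1 + theta k) * lam k) q)"
proof -
  have "\<forall>n\<ge>1. lam n = (if n = 1 then 1/4 * norm (x n - x (n - 1)) / norm (g n - g (n - 1))
      else min (sqrt (1 + theta (n - 1)) * lam (n - 1))
        (1/4 * norm (x n - x (n - 1)) / norm (g n - g (n - 1))))"
    using run unfolding adgd_def Let_def by blast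
  from this[rule_format, of "Suc k"] show ?thesis by (simp add: q_def r_def)
qed

lemma grad_change_pos: "norm (g (Suc k) - g k) > 0"
  using well_defined[of "Suc k"] by simp

lemma r_pos: "r k > 0"
proof -
  have "x (Suc k) \<noteq> x k" using well_defined[of "Suc k"] by auto
  then show ?thesis by (simp add: r_def)
qed

lemma lam_theta_pos: "lam k > 0 \<and> (k \<ge> 1 \<longrightarrow> theta k > 0)"
proof (induction k)
  case 0
  have "lam 0 > 0" using run unfolding adgd_def by (rule conjunct1)
  then show ?case by simp
next
  case (Suc k)
  then have "lam (Suc k) > 0"
    using stepsize[of k] r_pos[of k] grad_change_pos[of k] by auto
  with Suc show ?case by (simp add: theta_Suc)
qed

lemma lam_pos: "lam k > 0" and theta_pos: "k \<ge> 1 \<Longrightarrow> theta k > 0"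
  using lam_theta_pos by auto

lemma r_eq: "r k = lam k * norm (g k)"
  using lam_pos[of k] by (simp add: r_def iterate)

lemma local_curvature: "lam (Suc k) * norm (g (Suc k) - g k) \<le> r k / 4"
proof -
  have "lam (Suc k) \<le> 1/4 * r k / norm (g (Suc k) - g k)"
    using stepsize[of k] by auto
  then show ?thesis using grad_change_pos[of k] by (simp add: field_simps)
qed

lemma stepsize_cases:
  obtains "lam (Suc k) * norm (g (Suc k) - g k) = r k / 4"
  | "k \<ge> 1" "theta (Suc k) = sqrt (1 + theta k)"
proof (cases "lam (Suc k) = 1/4 * r k / norm (g (Suc k) - g k)")
  case True
  then show ?thesis using that(1) grad_change_pos[of k] by (simp add: field_simps)
next
  case False
  then have "k \<ge> 1" "lam (Suc k) = sqrt (1 + theta k) * lam k"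
    using stepsize[of k] by (auto split: if_splits simp: min_def)
  then show ?thesis using that(2) lam_pos[of k] by (simp add: theta_Suc)
qed

text \<open>The growth cap \<open>lam (Suc k) \<le> sqrt (1 + theta k) * lam k\<close>, squared and
  divided by \<open>lam k\<close>, is this inequality; it makes the averaged point a convex
  combination.\<close>

lemma weight_nonneg:
  assumes "k \<ge> 1"
  shows "adgd_weight lam theta k \<ge> 0"
proof -
  have "lam (Suc k) \<le> sqrt (1 + theta k) * lam k"
    using stepsize[of k] assms by auto
  then have "(lam (Suc k))\<^sup>2 \<le> (sqrt (1 + theta k) * lam k)\<^sup>2"
    using lam_pos[of "Suc k"] by (intro power_mono) auto
  also have "\<dots> = (1 + theta k) * lam k * lam k"
    using theta_pos[OF assms] by (simp add: power_mult_distrib power2_eq_square)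
  finally have "lam (Suc k) * lam (Suc k) / lam k \<le> (1 + theta k) * lam k"
    using lam_pos[of k] by (simp add: field_simps power2_eq_square)
  then show ?thesis by (simp add: adgd_weight_def theta_Suc mult.commute)
qed

lemma bonus_nonneg: "bonus k \<ge> 0"
  using nu_gt L0_pos L1_nonneg by (simp add: bonus_def)

lemma gap_nonneg: "gap k \<ge> 0"
  using minimizer by (simp add: gap_def)

text \<open>The usual Lyapunov step of AdGD, but keeping the gap term \<open>bonus\<close> of convexity at the minimizer
  and the surplus \<open>(r k)\<^sup>2 / 2\<close> that \<open>\<gamma> = 1/4\<close> leaves.\<close>

lemma energy_step:
  "(norm (x (Suc (Suc k)) - xstar))\<^sup>2 + 3/4 * (r (Suc k))\<^sup>2
     + 2 * (lam (Suc k) * (1 + theta (Suc k)) * gap (Suc k))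
     + 2 * (lam (Suc k) * bonus (Suc k)) + (r k)\<^sup>2 / 2
   \<le> (norm (x (Suc k) - xstar))\<^sup>2 + 3/4 * (r k)\<^sup>2
     + 2 * (lam (Suc k) * theta (Suc k) * gap k)"
proof -
  define n where "n = Suc k"
  define s where "s = x (Suc n) - x n"
  have s: "s = - lam n *\<^sub>R g n" by (simp add: s_def iterate)
  have rn: "(r n)\<^sup>2 = s \<bullet> s" by (simp add: r_def s_def power2_norm_eq_inner)
  have "(norm (u + s))\<^sup>2 = (norm u)\<^sup>2 + 2 * (u \<bullet> s) + s \<bullet> s" for u
    by (simp add: power2_norm_eq_inner inner_add inner_commute)
  from this[of "x n - xstar"]
  have "(norm (x (Suc n) - xstar))\<^sup>2 = (norm (x n - xstar))\<^sup>2 + 2 * ((x n - xstar) \<bullet> s) + s \<bullet> s"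
    by (simp add: s_def)
  also have "(x n - xstar) \<bullet> s = - (lam n * (g n \<bullet> (x n - xstar)))"
    by (simp add: s inner_commute)
  finally have dist: "(norm (x (Suc n) - xstar))\<^sup>2
      = (norm (x n - xstar))\<^sup>2 - 2 * (lam n * (g n \<bullet> (x n - xstar))) + (r n)\<^sup>2"
    by (simp add: rn)
  have progress: "lam n * (gap n + bonus n) \<le> lam n * (g n \<bullet> (x n - xstar))"
    using minimizer_gap[OF nu_eq, of "x n"] lam_pos[of n]
    by (intro mult_left_mono) (auto simp: bonus_def gap_def)
  \<comment> \<open>Write \<open>s \<bullet> s\<close> as
    \<open>- (lam n * (g n \<bullet> s))\<close> and split \<open>g n\<close> into
    \<open>g n - g k\<close> and \<open>g k\<close>. Local curvature controls the first part; in the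
    second, \<open>g k\<close> is a multiple of \<open>x k - x n\<close>, so convexity at
    \<open>x n\<close> applies.\<close>
  have change: "(r n)\<^sup>2 \<le> ((r k)\<^sup>2 + (r n)\<^sup>2) / 8 + lam n * theta n * (gap k - gap n)"
  proof -
    have "s \<bullet> s = - (lam n * ((g n - g k) \<bullet> s)) + - (lam n * (g k \<bullet> s))"
      by (subst (1) s) (simp add: inner_diff_left algebra_simps)
    moreover have "- (lam n * ((g n - g k) \<bullet> s)) \<le> ((r k)\<^sup>2 + (r n)\<^sup>2) / 8"
    proof -
      have "- ((g n - g k) \<bullet> s) \<le> norm (g n - g k) * norm s"
        using norm_cauchy_schwarz[of "- (g n - g k)" s] unfolding inner_minus_left norm_minus_cancel .
      then have "- (lam n * ((g n - g k) \<bullet> s)) \<le> lam n * (norm (g n - g k) * norm s)"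
        using lam_pos[of n] mult_left_mono[of "- ((g n - g k) \<bullet> s)" _ "lam n"] by fastforce
      also have "\<dots> \<le> r k / 4 * r n"
        using mult_right_mono[OF local_curvature[of k], of "r n"] r_pos[of n]
        by (simp add: n_def s_def r_def mult.assoc)
      also have "\<dots> \<le> ((r k)\<^sup>2 + (r n)\<^sup>2) / 8"
        using sum_squares_bound[of "r k" "r n"] by simp
      finally show ?thesis .
    qed
    moreover have "- (lam n * (g k \<bullet> s)) \<le> lam n * theta n * (gap k - gap n)"
    proof -
      have th: "theta n * lam k = lam n" using lam_pos[of k] by (simp add: n_def theta_Suc)
      have "x k - x n = lam k *\<^sub>R g k" by (simp add: n_def iterate)
      then have "g n \<bullet> (lam k *\<^sub>R g k) \<le> gap k - gap n"
        using above_tangent[of "x n" "x k"] by (simp add: gap_def)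
      then have "lam n * theta n * (g n \<bullet> (lam k *\<^sub>R g k)) \<le> lam n * theta n * (gap k - gap n)"
        using lam_pos[of n] theta_pos[of n] by (intro mult_left_mono) (auto simp: n_def)
      moreover have "- (lam n * (g k \<bullet> s)) = lam n * (theta n * lam k) * (g n \<bullet> g k)"
        by (simp add: s th inner_commute)
      ultimately show ?thesis by (simp add: mult.assoc)
    qed
    ultimately show ?thesis using rn by linarith
  qed
  \<comment> \<open>Doubling the second premise gives \<open>7/4 * q \<le> q' / 4 + 2 * W\<close>,
    so \<open>q' / 2\<close> of the available \<open>3/4 * q'\<close> remains.\<close>
  have arith: "d - 2 * c + q + 3/4 * q + 2 * X + 2 * U + q' / 2 \<le> d + 3/4 * q' + 2 * Z"
    if "V \<le> c" "q \<le> (q' + q) / 8 + W" "X + U = V + Y" "W = Z - Y" for d c q q' U V W X Y Z :: real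
  proof -
    have "X + U \<le> c + Y" using that by linarith
    moreover have "q \<le> q' / 8 + q / 8 + Z - Y" using that by (simp add: add_divide_distrib)
    ultimately show ?thesis by linarith
  qed
  have "lam n * (1 + theta n) * gap n + lam n * bonus n
      = lam n * (gap n + bonus n) + lam n * theta n * gap n"
    and "lam n * theta n * (gap k - gap n) = lam n * theta n * gap k - lam n * theta n * gap n"
    by (simp_all add: algebra_simps)
  from arith[OF progress change this] show ?thesis
    unfolding n_def[symmetric] dist .
qed

text \<open>\<open>D\<^sup>2\<close> is the energy before the first step. In the telescoping, the
  gap terms at \<open>x k\<close> from two consecutive steps combine to \<open>adgd_weight\<close>;
  only the last gap keeps its full coefficient.\<close>

lemma energy:
  assumes "N \<ge> 1"
  shows "(norm (x (Suc N) - xstar))\<^sup>2 + 3/4 * (r N)\<^sup>2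
     + (\<Sum>k=1..N. (r (k - 1))\<^sup>2 / 2 + 2 * (lam k * bonus k))
     + 2 * (lam N * (1 + theta N) * gap N + (\<Sum>k=1..N - 1. adgd_weight lam theta k * gap k))
     \<le> D\<^sup>2"
  using assms
proof (induction N rule: nat_induct_at_least)
  case base
  show ?case using energy_step[of 0] by (simp add: D_eq r_def gap_def)
next
  case (Suc N)
  then have "{1..Suc N - 1} = insert N {1..N - 1}" by auto
  then have last_weight: "(\<Sum>k=1..Suc N - 1. adgd_weight lam theta k * gap k)
      = adgd_weight lam theta N * gap N + (\<Sum>k=1..N - 1. adgd_weight lam theta k * gap k)"
    using Suc.hyps by simp
  have weight_split: "adgd_weight lam theta N * gap N
      = lam N * (1 + theta N) * gap N - lam (Suc N) * theta (Suc N) * gap N"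
    by (simp add: adgd_weight_def left_diff_distrib)
  have sum_split: "(\<Sum>k=1..Suc N. (r (k - 1))\<^sup>2 / 2 + 2 * (lam k * bonus k))
      = (\<Sum>k=1..N. (r (k - 1))\<^sup>2 / 2 + 2 * (lam k * bonus k))
        + ((r N)\<^sup>2 / 2 + 2 * (lam (Suc N) * bonus (Suc N)))"
    by simp
  have "P' + (R + (q + u)) + 2 * (l' + (l - t + W)) \<le> E"
    if "P + R + 2 * (l + W) \<le> E" "P' + 2 * l' + u + q \<le> P + 2 * t"
    for P P' R q u l l' t W E :: real
    using that unfolding distrib_left right_diff_distrib by linarith
  note arith = this[OF Suc.IH energy_step[of N]]
  from arith show ?case unfolding last_weight weight_split sum_split .
qed

lemma energy_parts_nonneg:
  assumes "N \<ge> 1"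
  shows "0 \<le> (\<Sum>k=1..N. (r (k - 1))\<^sup>2 / 2 + 2 * (lam k * bonus k))"
    and "0 \<le> lam N * (1 + theta N) * gap N + (\<Sum>k=1..N - 1. adgd_weight lam theta k * gap k)"
proof -
  show "0 \<le> (\<Sum>k=1..N. (r (k - 1))\<^sup>2 / 2 + 2 * (lam k * bonus k))"
    using bonus_nonneg lam_pos by (intro sum_nonneg) (simp add: less_imp_le)
  have "0 \<le> lam N * (1 + theta N) * gap N"
    using gap_nonneg[of N] lam_pos[of N] theta_pos[OF assms] by simp
  moreover have "0 \<le> (\<Sum>k=1..N - 1. adgd_weight lam theta k * gap k)"
    using weight_nonneg gap_nonneg by (intro sum_nonneg) simp
  ultimately show "0 \<le> lam N * (1 + theta N) * gap N
      + (\<Sum>k=1..N - 1. adgd_weight lam theta k * gap k)" by simp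
qed

lemma dist_step_le: "(norm (x (Suc k) - xstar))\<^sup>2 + 3/4 * (r k)\<^sup>2 \<le> D\<^sup>2"
proof (cases "k = 0")
  case True
  have "2 * lam 1 * theta 1 * gap 0 \<ge> 0"
    using lam_pos[of 1] theta_pos[of 1] gap_nonneg[of 0] by simp
  with True show ?thesis by (simp add: D_eq r_def gap_def)
next
  case False
  then show ?thesis using energy[of k] energy_parts_nonneg[of k] by simp
qed

lemma dist_le: "norm (x k - xstar) \<le> 153/100 * D"
proof (cases k)
  case (Suc n)
  then have "(norm (x k - xstar))\<^sup>2 \<le> D\<^sup>2"
    using dist_step_le[of n] zero_le_power2[of "r n"] unfolding Suc by linarith
  then have "norm (x k - xstar) \<le> D" by (rule power2_le_imp_le) (use D_pos in simp)
  then show ?thesis using D_pos by simp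
next
  case 0
  define d where "d = norm (x 1 - xstar)"
  have "norm (x 0 - xstar) \<le> d + r 0"
    using norm_triangle_ineq[of "x 1 - xstar" "x 0 - x 1"] by (simp add: d_def r_def norm_minus_commute)
  moreover have "(d + r 0)\<^sup>2 \<le> (153/100 * D)\<^sup>2"
  proof -
    \<comment> \<open>Weighted Cauchy-Schwarz, with \<open>7/3 = 1 + 4/3\<close>; it serves
      \<open>x 0\<close>, whose distance to \<open>xstar\<close> does not appear in the
      energy.\<close>
    have "0 \<le> (4/3) * (d - 3/4 * r 0)\<^sup>2" by simp
    then have "(d + r 0)\<^sup>2 \<le> 7/3 * (d\<^sup>2 + 3/4 * (r 0)\<^sup>2)"
      by (simp add: power2_eq_square algebra_simps)
    also have "\<dots> \<le> 7/3 * D\<^sup>2" using dist_step_le[of 0] by (simp add: d_def)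
    also have "\<dots> \<le> (153/100 * D)\<^sup>2" using D_pos by (simp add: power_mult_distrib power2_eq_square)
    finally show ?thesis .
  qed
  then have "d + r 0 \<le> 153/100 * D" by (rule power2_le_imp_le) (use D_pos in simp)
  ultimately show ?thesis using 0 by simp
qed

subsection \<open>Lower bounds on the stepsizes\<close>

text \<open>Dimensionless stepsize, with the factor 4 equal to \<open>1 / \<gamma>\<close>; adding
  \<open>4 * b k\<close> gives \<open>4 * lam k\<close> times the local weight at
  \<open>x k\<close>.\<close>

definition p :: "nat \<Rightarrow> real" where "p k = 4 * L0 * lam k"
definition b :: "nat \<Rightarrow> real" where "b k = L1 * r k"

lemma p_pos: "p k > 0" and b_nonneg: "b k \<ge> 0"
  using L0_pos L1_nonneg lam_pos[of k] r_pos[of k] by (simp_all add: p_def b_def)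

lemma p_b_eq: "p k + 4 * b k = 4 * lam k * (L0 + L1 * norm (g k))"
  by (simp add: p_def b_def r_eq algebra_simps)

text \<open>Equality turns an upper bound on the gradient change into a lower bound on the stepsize.
  The weight at the newer iterate gives the first estimate, which is useful after short steps; the
  ball containing all iterates gives the second, the floor from which recovery starts.\<close>

lemma curvature_step:
  assumes eq: "lam (Suc k) * norm (g (Suc k) - g k) = r k / 4"
  shows "exp (- b k) \<le> p (Suc k) + 4 * b (Suc k)" and "exp (- (153/100 * (L1 * D))) \<le> p (Suc k)"
proof -
  define \<psi> where "\<psi> = L0 + L1 * norm (g (Suc k))"
  have "norm (g (Suc k) - g k) \<le> \<psi> * exp (b k) * r k"
    using grad_diff_le_exp[of "x (Suc k)" "x k"] by (simp add: b_def r_def \<psi>_def)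
  then have "lam (Suc k) * norm (g (Suc k) - g k) \<le> lam (Suc k) * (\<psi> * exp (b k) * r k)"
    using lam_pos[of "Suc k"] by (intro mult_left_mono) auto
  then have "1 * r k \<le> (4 * lam (Suc k) * \<psi> * exp (b k)) * r k"
    using eq by (simp add: mult_ac)
  then have "1 \<le> 4 * lam (Suc k) * \<psi> * exp (b k)"
    using r_pos[of k] mult_le_cancel_right_pos by blast
  then show "exp (- b k) \<le> p (Suc k) + 4 * b (Suc k)"
    by (simp add: p_b_eq \<psi>_def[symmetric] exp_minus divide_simps)
  have "norm (g (Suc k) - g k) \<le> L0 * exp (153/100 * (L1 * D)) * r k"
    using grad_diff_le_near_minimizer[OF dist_le dist_le, of "Suc k" k] by (simp add: r_def mult_ac)
  then have "lam (Suc k) * norm (g (Suc k) - g k)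
      \<le> lam (Suc k) * (L0 * exp (153/100 * (L1 * D)) * r k)"
    using lam_pos[of "Suc k"] by (intro mult_left_mono) auto
  then have "1 * r k \<le> (p (Suc k) * exp (153/100 * (L1 * D))) * r k"
    using eq by (simp add: mult_ac p_def)
  then have "1 \<le> p (Suc k) * exp (153/100 * (L1 * D))"
    using r_pos[of k] mult_le_cancel_right_pos by blast
  then show "exp (- (153/100 * (L1 * D))) \<le> p (Suc k)"
    by (simp add: exp_minus field_simps)
qed

text \<open>For the second claim, bound \<open>norm (g k)\<close> by the triangle inequality through
  \<open>g (Suc k)\<close> and multiply by \<open>lam (Suc k)\<close>; local curvature makes the
  error at most \<open>r k / 4\<close>.\<close>

lemma growth_step:
  "p (Suc k) = theta (Suc k) * p k" "(theta (Suc k) - 1/4) * b k \<le> b (Suc k)"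
proof -
  have th: "theta (Suc k) * lam k = lam (Suc k)" using lam_pos[of k] by (simp add: theta_Suc)
  then show "p (Suc k) = theta (Suc k) * p k" by (simp add: p_def algebra_simps)
  have "theta (Suc k) * r k = lam (Suc k) * norm (g k)"
    by (simp add: r_eq flip: th)
  also have "\<dots> \<le> lam (Suc k) * (norm (g (Suc k)) + norm (g (Suc k) - g k))"
    using lam_pos[of "Suc k"] norm_triangle_sub[of "g k" "g (Suc k)"]
    by (intro mult_left_mono) (auto simp: norm_minus_commute)
  also have "\<dots> \<le> r (Suc k) + r k / 4"
    using local_curvature[of k] by (simp add: r_eq[of "Suc k"] algebra_simps)
  finally have "L1 * ((theta (Suc k) - 1/4) * r k) \<le> L1 * r (Suc k)"
    using L1_nonneg by (intro mult_left_mono) (auto simp: algebra_simps)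
  then show "(theta (Suc k) - 1/4) * b k \<le> b (Suc k)" by (simp add: b_def mult_ac)
qed

lemma energy_scaled:
  assumes "N \<ge> 1"
  shows "(\<Sum>k=1..N. (b (k - 1))\<^sup>2 + 8 * \<nu> * (b k)\<^sup>2 / (p k + 4 * b k)) \<le> 2 * (L1 * D)\<^sup>2"
proof -
  have "(b (k - 1))\<^sup>2 + 8 * \<nu> * (b k)\<^sup>2 / (p k + 4 * b k)
      = 2 * L1\<^sup>2 * ((r (k - 1))\<^sup>2 / 2 + 2 * (lam k * bonus k))" for k
  proof -
    define \<psi> where "\<psi> = L0 + L1 * norm (g k)"
    have "\<psi> > 0" using L0_pos L1_nonneg by (simp add: \<psi>_def add_pos_nonneg)
    then have "8 * \<nu> * (b k)\<^sup>2 / (p k + 4 * b k) = 4 * L1\<^sup>2 * (lam k * bonus k)"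
      using lam_pos[of k] unfolding p_b_eq bonus_def \<psi>_def[symmetric]
      by (simp add: b_def r_eq field_simps power2_eq_square)
    then show ?thesis by (simp add: b_def power_mult_distrib algebra_simps)
  qed
  then have "(\<Sum>k=1..N. (b (k - 1))\<^sup>2 + 8 * \<nu> * (b k)\<^sup>2 / (p k + 4 * b k))
      = 2 * L1\<^sup>2 * (\<Sum>k=1..N. (r (k - 1))\<^sup>2 / 2 + 2 * (lam k * bonus k))"
    by (simp add: sum_distrib_left)
  also have "\<dots> \<le> 2 * L1\<^sup>2 * D\<^sup>2"
  proof (rule mult_left_mono)
    have "R \<le> E" if "P + R + 2 * Q \<le> E" "0 \<le> P" "0 \<le> Q" for P Q R E :: real
      using that by simp
    from this[OF energy[OF assms] _ energy_parts_nonneg(2)[OF assms]]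
    show "(\<Sum>k=1..N. (r (k - 1))\<^sup>2 / 2 + 2 * (lam k * bonus k)) \<le> D\<^sup>2" by simp
  qed simp
  finally show ?thesis by (simp add: power_mult_distrib)
qed

lemma total_stepsize:
  fixes m :: real
  assumes m: "m = 1 + log (sqrt 2) (real_of_int \<lceil>(1 + L1 * D * exp (2 * L1 * D)) / 2\<rceil>)"
    and N: "N \<ge> 1"
  shows "m \<ge> 1"
    and "\<nu> * (real N - m * (2 * L1\<^sup>2 * D\<^sup>2 / \<nu>\<^sup>2)) - sqrt (2 * real N) * (m + 1) * L1 * D
      \<le> 4 * L0 * (\<Sum>k=1..N. lam k)"
proof -
  define A where "A = L1 * D"
  define C where "C = real_of_int \<lceil>(1 + A * exp (2 * A)) / 2\<rceil>"
  define z where "z k = sqrt (8 * \<nu>) * b k / sqrt (p k + 4 * b k)" for k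
  have \<nu>_pos: "\<nu> > 0" using nu_gt by simp
  have A: "A \<ge> 0" using L1_nonneg D_pos by (simp add: A_def)
  have "(1 + A * exp (2 * A)) / 2 > 0" using A by (simp add: add_pos_nonneg)
  then have C1: "C \<ge> 1" by (simp add: C_def)
  have mC: "m = 1 + log (sqrt 2) C" by (simp add: m C_def A_def mult.assoc)
  show m1: "m \<ge> 1" using C1 by (simp add: mC)
  \<comment> \<open>\<open>m\<close> is chosen for this: climbing by a factor \<open>C\<close> takes
    \<open>m - 1\<close> growth steps of ratio \<open>sqrt 2\<close>.\<close>
  have powC: "sqrt 2 powr (m - 1) = C" using C1 by (simp add: mC)
  \<comment> \<open>The energy bounds \<open>3/4 * (r (k - 1))\<^sup>2\<close> by
    \<open>D\<^sup>2\<close>, so a long step can occur only if \<open>A\<close> is large.\<close>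
  have recovery: "\<nu> \<le> sqrt 2 powr (m - 1) * exp (- (153/100 * A))"
    if "k \<ge> 1" "\<nu> < b (k - 1)" for k
  proof -
    have "\<nu>\<^sup>2 < (b (k - 1))\<^sup>2" using that \<nu>_pos by (intro power_strict_mono) auto
    moreover have "3/4 * (r (k - 1))\<^sup>2 \<le> D\<^sup>2"
      using dist_step_le[of "k - 1"] zero_le_power2[of "norm (x (Suc (k - 1)) - xstar)"] by linarith
    then have "L1\<^sup>2 * (3/4 * (r (k - 1))\<^sup>2) \<le> L1\<^sup>2 * D\<^sup>2"
      by (intro mult_left_mono) auto
    ultimately have "3/4 * \<nu>\<^sup>2 < A\<^sup>2" by (simp add: b_def A_def power_mult_distrib)
    from recovery_factor[OF A this] show ?thesis by (simp add: powC C_def)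
  qed
  have dichotomy: "(exp (- b (k - 1)) \<le> p k + 4 * b k \<and> exp (- (153/100 * A)) \<le> p k) \<or>
       (k \<ge> 2 \<and> theta k = sqrt (1 + theta (k - 1)) \<and> p k = theta k * p (k - 1)
         \<and> (theta k - 1/4) * b (k - 1) \<le> b k)" if k: "k \<ge> 1" for k
  proof -
    obtain n where n: "k = Suc n" using k by (cases k) auto
    show ?thesis
      using stepsize_cases[of n] curvature_step[of n] growth_step[of n] by (auto simp: n A_def)
  qed
  have "\<nu> * real N \<le> (\<Sum>k=1..N. p k + ((m + 1) * z k + m / \<nu> * (b (k - 1))\<^sup>2))"
    unfolding z_def
    by (rule amortised_stepsizes[OF m1 _ p_pos b_nonneg theta_pos dichotomy recovery N]) auto
  also have "\<dots> = 4 * L0 * (\<Sum>k=1..N. lam k) + (m + 1) * (\<Sum>k=1..N. z k)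
      + m / \<nu> * (\<Sum>k=1..N. (b (k - 1))\<^sup>2)"
    by (simp add: sum.distrib sum_distrib_left p_def)
  finally have main: "\<nu> * real N \<le> \<dots>" .
  have z2: "(z k)\<^sup>2 = 8 * \<nu> * (b k)\<^sup>2 / (p k + 4 * b k)" for k
    using \<nu>_pos p_pos[of k] b_nonneg[of k] by (simp add: z_def power_mult_distrib power_divide)
  \<comment> \<open>Both sums share the budget \<open>2 * A\<^sup>2\<close>, and each is estimated
    by all of it. Cauchy-Schwarz then passes from the squares of \<open>z\<close> to their sum,
    which is the source of \<open>sqrt (2 * real N)\<close>.\<close>
  have split: "(\<Sum>k=1..N. (b (k - 1))\<^sup>2) + (\<Sum>k=1..N. (z k)\<^sup>2) \<le> 2 * A\<^sup>2"
    using energy_scaled[OF N] by (simp add: z2 A_def sum.distrib)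
  have "(\<Sum>k=1..N. (b (k - 1))\<^sup>2) \<ge> 0" "(\<Sum>k=1..N. (z k)\<^sup>2) \<ge> 0"
    by (simp_all add: sum_nonneg)
  with split have b_le: "(\<Sum>k=1..N. (b (k - 1))\<^sup>2) \<le> 2 * A\<^sup>2" and z_le: "(\<Sum>k=1..N. (z k)\<^sup>2) \<le> 2 * A\<^sup>2"
    by linarith+
  have "(\<Sum>k=1..N. z k)\<^sup>2 \<le> real N * (\<Sum>k=1..N. (z k)\<^sup>2)"
    using Cauchy_Schwarz_ineq_sum[of "\<lambda>_. 1" z "{1..N}"] by simp
  also have "\<dots> \<le> real N * (2 * A\<^sup>2)" using z_le by (intro mult_left_mono) auto
  also have "\<dots> = (sqrt (2 * real N) * A)\<^sup>2" by (simp add: power_mult_distrib)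
  finally have "(\<Sum>k=1..N. z k) \<le> sqrt (2 * real N) * A"
    by (rule power2_le_imp_le) (use A in simp)
  then have "(m + 1) * (\<Sum>k=1..N. z k) \<le> (m + 1) * (sqrt (2 * real N) * A)"
    using m1 by (intro mult_left_mono) auto
  moreover have "m / \<nu> * (\<Sum>k=1..N. (b (k - 1))\<^sup>2) \<le> m / \<nu> * (2 * A\<^sup>2)"
    using b_le m1 \<nu>_pos by (intro mult_left_mono) auto
  moreover have "m / \<nu> * (2 * A\<^sup>2) = \<nu> * (m * (2 * L1\<^sup>2 * D\<^sup>2 / \<nu>\<^sup>2))"
    using \<nu>_pos by (simp add: A_def power_mult_distrib power2_eq_square)
  ultimately show "\<nu> * (real N - m * (2 * L1\<^sup>2 * D\<^sup>2 / \<nu>\<^sup>2)) - sqrt (2 * real N) * (m + 1) * L1 * D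
      \<le> 4 * L0 * (\<Sum>k=1..N. lam k)"
    using main by (simp add: A_def algebra_simps)
qed

section \<open>Averaging and the convergence rate\<close>

lemma total_eq_sum_weights:
  assumes "N \<ge> 1"
  shows "adgd_total lam theta N = lam N * (1 + theta N) + (\<Sum>k=1..N - 1. adgd_weight lam theta k)"
  using assms
proof (induction N rule: nat_induct_at_least)
  case base
  show ?case by (simp add: adgd_total_def algebra_simps)
next
  case (Suc N)
  then obtain n where N: "N = Suc n" by (cases N) auto
  show ?case using Suc.IH by (simp add: N adgd_total_def adgd_weight_def algebra_simps)
qed

lemma total_pos:
  assumes "N \<ge> 1"
  shows "adgd_total lam theta N > 0"
proof -
  have "(\<Sum>k=1..N. lam k) > 0" using lam_pos assms by (intro sum_pos) auto
  then show ?thesis using lam_pos[of 1] theta_pos[of 1] by (simp add: adgd_total_def add_pos_pos)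
qed

text \<open>Jensen's inequality with the weights \<open>c k / S\<close>, which are nonnegative by
  \<open>weight_nonneg\<close> and sum to 1; the energy bounds the weighted gaps by
  \<open>D\<^sup>2 / 2\<close>.\<close>

lemma gap_average:
  assumes N: "N \<ge> 1"
  shows "f (adgd_avg x lam theta N) - f xstar \<le> D\<^sup>2 / (2 * adgd_total lam theta N)"
proof -
  define S where "S = adgd_total lam theta N"
  define c where "c k = (if k = N then lam N * (1 + theta N) else adgd_weight lam theta k)" for k
  have S: "S > 0" using total_pos[OF N] by (simp add: S_def)
  have split: "(\<Sum>k=1..N. h (c k) k) = h (lam N * (1 + theta N)) N
      + (\<Sum>k=1..N - 1. h (adgd_weight lam theta k) k)" for h :: "real \<Rightarrow> nat \<Rightarrow> 'b::comm_monoid_add"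
  proof -
    have "{1..N} = insert N {1..N - 1}" using N by auto
    then have "(\<Sum>k=1..N. h (c k) k) = h (c N) N + (\<Sum>k=1..N - 1. h (c k) k)"
      using N by simp
    also have "(\<Sum>k=1..N - 1. h (c k) k) = (\<Sum>k=1..N - 1. h (adgd_weight lam theta k) k)"
      by (rule sum.cong) (auto simp: c_def)
    finally show ?thesis by (simp add: c_def)
  qed
  have c_nonneg: "c k \<ge> 0" if "k \<in> {1..N}" for k
    using that weight_nonneg[of k] lam_pos[of N] theta_pos[OF N] by (auto simp: c_def)
  have cS: "(\<Sum>k=1..N. c k) = S"
    using total_eq_sum_weights[OF N] split[of "\<lambda>a k. a"] by (simp add: S_def)
  have avg: "adgd_avg x lam theta N = (\<Sum>k=1..N. (c k / S) *\<^sub>R x k)"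
    unfolding adgd_avg_def S_def[symmetric] split[of "\<lambda>a k. a *\<^sub>R x k", symmetric]
    by (simp add: scaleR_sum_right)
  have "f (adgd_avg x lam theta N) \<le> (\<Sum>k=1..N. c k / S * f (x k))"
    unfolding avg using N c_nonneg S cS
    by (intro convex_on_sum[OF _ _ convex]) (auto simp flip: sum_divide_distrib)
  also have "\<dots> = f xstar + (\<Sum>k=1..N. c k * gap k) / S"
  proof -
    have "(\<Sum>k=1..N. c k * gap k) = (\<Sum>k=1..N. c k * f (x k)) - S * f xstar"
      by (simp add: gap_def algebra_simps sum_subtractf cS[symmetric] sum_distrib_left)
    then show ?thesis using S by (simp add: diff_divide_distrib sum_divide_distrib)
  qed
  also have "(\<Sum>k=1..N. c k * gap k) \<le> D\<^sup>2 / 2"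
  proof -
    have "Q \<le> E / 2" if "P + R + 2 * Q \<le> E" "0 \<le> P" "0 \<le> R" for P Q R E :: real
      using that by simp
    from this[OF energy[OF N] _ energy_parts_nonneg(1)[OF N]] show ?thesis
      unfolding split[of "\<lambda>a k. a * gap k"] by simp
  qed
  finally show ?thesis using S by (simp add: S_def divide_right_mono)
qed

text \<open>The free lower bound \<open>Q\<close> for the denominator serves both claims of the
  theorem: the first takes the denominator itself, the second
  \<open>\<nu> * (real N / 2)\<close>.\<close>

lemma convergence_rate:
  fixes m :: real
  assumes m: "m = 1 + log (sqrt 2) (real_of_int \<lceil>(1 + L1 * D * exp (2 * L1 * D)) / 2\<rceil>)"
    and N: "N \<ge> 1" and Q: "Q > 0"
    and Q_le: "Q \<le> \<nu> * (real N - m * (2 * L1\<^sup>2 * D\<^sup>2 / \<nu>\<^sup>2))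
      - sqrt (2 * real N) * (m + 1) * L1 * D"
  shows "f (adgd_avg x lam theta N) - f xstar \<le> 2 * L0 * D\<^sup>2 / Q"
proof -
  have "Q \<le> 4 * L0 * (\<Sum>k=1..N. lam k)" using total_stepsize(2)[OF m N] Q_le by simp
  also have "\<dots> \<le> 4 * L0 * adgd_total lam theta N"
    using L0_pos lam_pos[of 1] theta_pos[of 1] by (simp add: adgd_total_def)
  finally have "Q \<le> 4 * L0 * adgd_total lam theta N" .
  then have "2 * L0 * D\<^sup>2 / (4 * L0 * adgd_total lam theta N) \<le> 2 * L0 * D\<^sup>2 / Q"
    using Q L0_pos by (intro divide_left_mono) auto
  moreover have "2 * L0 * D\<^sup>2 / (4 * L0 * adgd_total lam theta N)
      = D\<^sup>2 / (2 * adgd_total lam theta N)"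
    using L0_pos by simp
  ultimately show ?thesis using gap_average[OF N] by simp
qed

end

theorem theorem6p1:
  fixes f :: "real ^ 'd \<Rightarrow> real"
    and x :: "nat \<Rightarrow> real ^ 'd" and xstar :: "real ^ 'd"
    and lam theta :: "nat \<Rightarrow> real"
    and L0 L1 D m K \<nu> :: real
  assumes "L0 > 0" and "L1 \<ge> 0"
    and "\<And>y. f differentiable (at y)"
    and "convex_on UNIV f"
    and "sym_smooth L0 L1 f"
    and "\<And>y. f xstar \<le> f y"
    and "adgd (1/4) f x lam theta"
    and "\<And>k. k \<ge> 1 \<Longrightarrow> grad f (x k) \<noteq> grad f (x (k - 1))"
    and "\<nu> = exp (- \<nu>)"
    and "D > 0"
    and "D\<^sup>2 = (norm (x 1 - xstar))\<^sup>2 + 3/4 * (norm (x 1 - x 0))\<^sup>2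
                + 2 * lam 1 * theta 1 * (f (x 0) - f xstar)"
    and "m = 1 + log (sqrt 2) (real_of_int \<lceil>(1 + L1 * D * exp (2 * L1 * D)) / 2\<rceil>)"
    and "K = 2 * L1\<^sup>2 * D\<^sup>2 / \<nu>\<^sup>2"
  shows "(\<forall>N::nat. N \<ge> 1 \<longrightarrow>
            real N > m * K + sqrt (2 * real N) * (m + 1) * L1 * D / \<nu> \<longrightarrow>
            f (adgd_avg x lam theta N) - f xstar
              \<le> 2 * L0 * D\<^sup>2 /
                (\<nu> * (real N - m * K) - sqrt (2 * real N) * (m + 1) * L1 * D))
       \<and> (\<forall>N::nat. N \<ge> 1 \<longrightarrow>
            real N \<ge> (2 * m * K + 4 * (m + 1) * L1 * D / \<nu>)\<^sup>2 \<longrightarrow>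
            f (adgd_avg x lam theta N) - f xstar \<le> 4 * L0 * D\<^sup>2 / (\<nu> * real N))"
proof -
  interpret adgd_run f L0 L1 xstar \<nu> x lam theta D
    by unfold_locales (use assms in blast)+
  have \<nu>_pos: "\<nu> > 0" using nu_gt by simp
  have m1: "m \<ge> 1" by (rule total_stepsize(1)[OF assms(12), of 1]) simp
  define B where "B = (m + 1) * L1 * D / \<nu>"
  have B: "B \<ge> 0" using m1 \<open>L1 \<ge> 0\<close> \<open>D > 0\<close> \<nu>_pos by (simp add: B_def)
  have mK: "m * K \<ge> 0" using m1 by (simp add: assms(13))
  have denominator: "\<nu> * (real N - m * K) - sqrt (2 * real N) * (m + 1) * L1 * D
      = \<nu> * (real N - m * K - sqrt (2 * real N) * B)" for N
    using \<nu>_pos by (simp add: B_def field_simps)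
  note rate = convergence_rate[OF assms(12), folded assms(13), unfolded denominator]
  show ?thesis
    unfolding denominator
  proof (intro conjI allI impI)
    fix N :: nat assume N: "N \<ge> 1"
      and large: "real N > m * K + sqrt (2 * real N) * (m + 1) * L1 * D / \<nu>"
    have "sqrt (2 * real N) * (m + 1) * L1 * D / \<nu> = sqrt (2 * real N) * B" by (simp add: B_def)
    with large \<nu>_pos have "\<nu> * (real N - m * K - sqrt (2 * real N) * B) > 0" by simp
    from rate[OF N this] show "f (adgd_avg x lam theta N) - f xstar
        \<le> 2 * L0 * D\<^sup>2 / (\<nu> * (real N - m * K - sqrt (2 * real N) * B))" by simp
  next
    fix N :: nat assume N: "N \<ge> 1"
      and large: "real N \<ge> (2 * m * K + 4 * (m + 1) * L1 * D / \<nu>)\<^sup>2"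
    \<comment> \<open>The hypothesis becomes \<open>2 * (m * K) + 4 * B \<le> s\<close>. Multiplied
      by \<open>s\<close> and halved, it absorbs \<open>m * K\<close> because
      \<open>s \<ge> 1\<close> and the square-root term because \<open>sqrt 2 \<le> 2\<close>,
      leaving \<open>real N / 2\<close>.\<close>
    define s where "s = sqrt (real N)"
    have s1: "s \<ge> 1" using N by (simp add: s_def)
    have s2: "s * s = real N" by (simp add: s_def)
    have "2 * m * K + 4 * (m + 1) * L1 * D / \<nu> = 2 * (m * K) + 4 * B" by (simp add: B_def)
    then have "2 * (m * K) + 4 * B \<le> s"
      using large unfolding s_def by (intro real_le_rsqrt) (simp only:)
    then have "(2 * (m * K) + 4 * B) * s \<le> real N"
      using s1 unfolding s2[symmetric] by (intro mult_right_mono) auto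
    moreover have "m * K \<le> (m * K) * s" using mult_left_mono[OF s1 mK] by simp
    moreover have "sqrt (2 * real N) * B \<le> 2 * (B * s)"
    proof -
      have "sqrt (2 * real N) = sqrt 2 * s" by (simp add: s_def real_sqrt_mult)
      moreover have "sqrt 2 * s * B \<le> 2 * s * B"
        using sqrt2_less_2 s1 B by (intro mult_right_mono) auto
      ultimately show ?thesis by (simp add: mult_ac)
    qed
    ultimately have "real N / 2 \<le> real N - m * K - sqrt (2 * real N) * B"
      by (simp add: algebra_simps)
    then have "\<nu> * (real N / 2) \<le> \<nu> * (real N - m * K - sqrt (2 * real N) * B)"
      using \<nu>_pos by (intro mult_left_mono) auto
    moreover have "\<nu> * (real N / 2) > 0" using \<nu>_pos N by simp
    ultimately have "f (adgd_avg x lam theta N) - f xstar \<le> 2 * L0 * D\<^sup>2 / (\<nu> * (real N / 2))"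
      by (intro rate N)
    then show "f (adgd_avg x lam theta N) - f xstar \<le> 4 * L0 * D\<^sup>2 / (\<nu> * real N)"
      by (simp add: field_simps)
  qed
qed

end
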